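(* Let $Z$ be a Banach space over $\mathbb{K}$ and let $u\in S_Z$. If there exists a smooth point $z_0$ in $Z$ such that $z_0\perp_B u$, then $(Z,v_u)$ is not isometrically isomorphic to $Z$. In particular, $u$ is not a spear vector or, in other words, $$\Bigl(\bigcup_{z\in\operatorname{Smooth}(Z)}z^\perp\Bigr)\cap\operatorname{Spear}(Z)=\emptyset\quad\text{and}\quad\operatorname{Smooth}(Z)\cap\Bigl(\bigcup_{z\in\operatorname{Spear}(Z)}{}^\perp z\Bigr)=\emptyset.$$
   Context: $\mathbb{K}$ is $\mathbb{R}$ or $\mathbb{C}$. $S_Z$ and $S_{Z^*}$ are the unit spheres of $Z$ and of its dual $Z^*$. $x\perp_B y$ (Birkhoff-James orthogonality) means $\|x+\lambda y\|\geq\|x\|$ for all $\lambda\in\mathbb{K}$. A point $z\in Z$ is smooth if $\{\phi\in S_{Z^*}\colon\phi(z)=\|z\|\}$ is a singleton; $\operatorname{Smooth}(Z)$ is the set of smooth points of $Z$. For $u\in S_Z$, the numerical radius with respect to $u$ is the seminorm $v_u(z):=\sup\{|\phi(z)|\colon\phi\in S_{Z^*},\ \phi(u)=1\}$, which satisfies $v_u(z)\leq\|z\|$ for all $z\in Z$; $(Z,v_u)$ denotes the vector space $Z$ endowed with $v_u$. The vector $u\in S_Z$ is a spear vector if $v_u(z)=\|z\|$ for all $z\in Z$, and $\operatorname{Spear}(Z)$ is the set of spear vectors of $Z$. For $z\in Z$, $z^\perp=\{x\in Z\colon z\perp_B x\}$ and ${}^\perp z=\{x\in Z\colon x\perp_B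 z\}$.
   Formalization: "(Z,v_u) is not isometrically isomorphic to Z" is proved only for isometric isomorphisms that fix u (the identity included); for arbitrary isometric isomorphisms the claim is false, e.g. for a suitable real l_infinity-sum. *)

theory Defs
  imports "HOL-Analysis.Analysis"
begin

text \<open>
  The scalar field is the real or the complex field, up to an isometric isomorphism of
  real normed algebras.
\<close>

class real_or_complex = real_normed_field +
  assumes real_or_complex:
    "(\<exists>h :: 'a \<Rightarrow> real. bij h \<and> (\<forall>x y. h (x + y) = h x + h y) \<and> (\<forall>r x. h (r *\<^sub>R x) = r *\<^sub>R h x) \<and>
        (\<forall>x y. h (x * y) = h x * h y) \<and> (\<forall>x. norm (h x) = norm x)) \<or>
     (\<exists>h :: 'a \<Rightarrow> complex. bij h \<and> (\<forall>x y. h (x + y) = h x + h y) \<and> (\<forall>r x. h (r *\<^sub>R x) = r *\<^sub>R h x) \<and>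
        (\<forall>x y. h (x * y) = h x * h y) \<and> (\<forall>x. norm (h x) = norm x))"

instance real :: real_or_complex
  by standard (rule disjI1, rule exI[of _ id], simp)

instance complex :: real_or_complex
  by standard (rule disjI2, rule exI[of _ id], simp)

text \<open>
  A Banach space over the scalar field: the class \<open>banach\<close> supplies the complete norm and the
  real scaling, which is the restriction of the scaling by \<open>'k\<close>.
\<close>

locale banach_over = vector_space scl
  for scl :: "'k::real_or_complex \<Rightarrow> 'z::banach \<Rightarrow> 'z" +
  assumes norm_scl: "norm (scl c x) = norm c * norm x"
    and scl_of_real: "scl (of_real r) x = r *\<^sub>R x"

text \<open>
  In the definitions below, \<open>bounded_linear\<close> is the library's notion for the underlying real
  spaces; linearity over \<open>'k\<close> is required separately.
\<close>

definition dual_sphere :: "('k::real_or_complex \<Rightarrow> 'z::banach \<Rightarrow> 'z) \<Rightarrow> ('z \<Rightarrow> 'k) set" where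
  "dual_sphere scl = {\<phi>. Vector_Spaces.linear scl (*) \<phi> \<and> bounded_linear \<phi> \<and> onorm \<phi> = 1}"

definition bj_orth :: "('k::real_or_complex \<Rightarrow> 'z::banach \<Rightarrow> 'z) \<Rightarrow> 'z \<Rightarrow> 'z \<Rightarrow> bool" where
  "bj_orth scl x y \<longleftrightarrow> (\<forall>c. norm (x + scl c y) \<ge> norm x)"

definition right_perp :: "('k::real_or_complex \<Rightarrow> 'z::banach \<Rightarrow> 'z) \<Rightarrow> 'z \<Rightarrow> 'z set" where
  "right_perp scl z = {x. bj_orth scl z x}"

definition left_perp :: "('k::real_or_complex \<Rightarrow> 'z::banach \<Rightarrow> 'z) \<Rightarrow> 'z \<Rightarrow> 'z set" where
  "left_perp scl z = {x. bj_orth scl x z}"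

definition Smooth :: "('k::real_or_complex \<Rightarrow> 'z::banach \<Rightarrow> 'z) \<Rightarrow> 'z set" where
  "Smooth scl = {z. is_singleton {\<phi> \<in> dual_sphere scl. \<phi> z = of_real (norm z)}}"

definition num_radius :: "('k::real_or_complex \<Rightarrow> 'z::banach \<Rightarrow> 'z) \<Rightarrow> 'z \<Rightarrow> 'z \<Rightarrow> real" where
  "num_radius scl u z = (SUP \<phi>\<in>{\<phi> \<in> dual_sphere scl. \<phi> u = 1}. norm (\<phi> z))"

definition Spear :: "('k::real_or_complex \<Rightarrow> 'z::banach \<Rightarrow> 'z) \<Rightarrow> 'z set" where
  "Spear scl = {u \<in> sphere 0 1. \<forall>z. num_radius scl u z = norm z}"

text \<open>
  Isometric isomorphisms from the space endowed with the seminorm \<open>p\<close> onto the same vector space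
  endowed with the seminorm \<open>q\<close>.
\<close>

definition isometric_isomorphism ::
    "('k::real_or_complex \<Rightarrow> 'z::banach \<Rightarrow> 'z) \<Rightarrow> ('z \<Rightarrow> real) \<Rightarrow> ('z \<Rightarrow> real) \<Rightarrow> ('z \<Rightarrow> 'z) \<Rightarrow> bool" where
  "isometric_isomorphism scl p q T \<longleftrightarrow>
     Vector_Spaces.linear scl scl T \<and> bij T \<and> (\<forall>z. q (T z) = p z)"

text \<open>
  \<open>(Z, v\<^sub>u)\<close> and \<open>Z\<close> are to be compared as spaces with distinguished vector \<open>u\<close>, that is,
  by isometric isomorphisms fixing \<open>u\<close>; the identity map is such a map exactly when \<open>u\<close> is a
  spear vector. Without this requirement the non-isomorphism fails: let \<open>W\<close> be real 3-space with
  the norm \<open>max\<^sub>i \<bar>p\<^sub>i x + q\<^sub>i y + t\<bar>\<close>, where \<open>(p\<^sub>i, q\<^sub>i)\<close> runs through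
  \<open>(-1,1), (1,1), (2,0), (0,-1), (-2,0)\<close>. Put \<open>w = (0,1,0)\<close> and \<open>s = (0,0,1)\<close>; then \<open>s\<close> is a
  spear vector of \<open>W\<close>, while \<open>(W, v\<^sub>w)\<close> is isometric to 3-dimensional \<open>\<ell>\<^sub>\<infinity>\<close>. In the
  \<open>\<ell>\<^sub>\<infinity>\<close>-sum \<open>Z\<close> of countably many copies of \<open>W\<close> and of \<open>\<ell>\<^sub>\<infinity>\<close>, with
  \<open>u = (w, s, s, \<dots>; 1, 1, \<dots>)\<close>, the seminorm \<open>v\<^sub>u\<close> only turns the first \<open>W\<close> into a
  3-dimensional \<open>\<ell>\<^sub>\<infinity>\<close>, which the summand \<open>\<ell>\<^sub>\<infinity>\<close> absorbs, so \<open>(Z, v\<^sub>u)\<close> is isometric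
  to \<open>Z\<close>; yet \<open>((1,0,1), 0, 0, \<dots>; 0, 0, \<dots>)\<close> is smooth and orthogonal to \<open>u\<close>.
\<close>

end

theory Submission
  imports Defs
begin

text \<open>
  If \<open>u\<close> is a spear vector, compactness of the scalar unit sphere yields a unimodular \<open>\<theta>\<close> with
  \<open>\<parallel>z\<^sub>0 + \<theta> u\<parallel> = \<parallel>z\<^sub>0\<parallel> + 1\<close>, and a functional norming \<open>z\<^sub>0 + \<theta> u\<close> supports \<open>z\<^sub>0\<close> without
  vanishing at \<open>u\<close>. If moreover \<open>z\<^sub>0 \<bottom>\<^sub>B u\<close>, the Hahn-Banach theorem for the quotient seminorm
  modulo \<open>u\<close> yields a functional that supports \<open>z\<^sub>0\<close> and vanishes at \<open>u\<close>; so \<open>z\<^sub>0\<close> is not smooth.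
  An isometric isomorphism \<open>T\<close> from \<open>(Z, v\<^sub>u)\<close> onto \<open>Z\<close> fixing \<open>u\<close> makes \<open>u\<close> a spear vector, because
  \<open>\<phi> \<mapsto> \<phi> \<circ> T\<^sup>-\<^sup>1\<close> maps the functionals defining \<open>v\<^sub>u\<close> into themselves.
\<close>

section \<open>The Hahn-Banach theorem\<close>

text \<open>Homogeneity is asked only as an inequality, which is easier to verify for infima;
  equality follows by rescaling with \<open>1/t\<close>.\<close>

definition sublinear :: "('a::real_vector \<Rightarrow> real) \<Rightarrow> bool" where
  "sublinear q \<longleftrightarrow> (\<forall>x y. q (x + y) \<le> q x + q y) \<and> (\<forall>t\<ge>0. \<forall>x. q (t *\<^sub>R x) \<le> t * q x)"

lemma sublinear_add: "sublinear q \<Longrightarrow> q (x + y) \<le> q x + q y"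
  by (simp add: sublinear_def)

lemma sublinear_scaleR_le: "sublinear q \<Longrightarrow> t \<ge> 0 \<Longrightarrow> q (t *\<^sub>R x) \<le> t * q x"
  by (simp add: sublinear_def)

lemma sublinear_zero: "sublinear q \<Longrightarrow> q 0 = 0"
  using sublinear_add[of q 0 0] sublinear_scaleR_le[of q 0 0] by auto

lemma sublinear_scaleR:
  assumes "sublinear q" "t \<ge> 0"
  shows "q (t *\<^sub>R x) = t * q x"
proof (cases "t = 0")
  case True
  then show ?thesis using sublinear_zero[OF assms(1)] by simp
next
  case False
  then have t: "t > 0" using assms by simp
  have "q ((1/t) *\<^sub>R t *\<^sub>R x) \<le> (1/t) * q (t *\<^sub>R x)"
    using t by (intro sublinear_scaleR_le assms) auto
  then have "q x \<le> (1/t) * q (t *\<^sub>R x)"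
    using t by simp
  then have "t * q x \<le> q (t *\<^sub>R x)"
    using t by (simp add: field_simps)
  then show ?thesis using sublinear_scaleR_le[OF assms, of x] by simp
qed

lemma sublinear_uminus: "sublinear q \<Longrightarrow> - q (- x) \<le> q x"
  using sublinear_add[of q x "- x"] sublinear_zero[of q] by simp

text \<open>The largest sublinear functional below \<open>q\<close> whose value at
  \<open>- y\<close> is at most \<open>- q y\<close>. Passing to it is how a sublinear functional
  that is not yet linear gets lowered.\<close>

definition sublinear_along :: "('a::real_vector \<Rightarrow> real) \<Rightarrow> 'a \<Rightarrow> 'a \<Rightarrow> real" where
  "sublinear_along q y x = (INF t\<in>{0..}. q (x + t *\<^sub>R y) - t * q y)"

lemma sublinear_along_le:
  assumes "sublinear q" "t \<ge> 0"
  shows "sublinear_along q y x \<le> q (x + t *\<^sub>R y) - t * q y"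
  unfolding sublinear_along_def
proof (rule cINF_lower)
  show "bdd_below ((\<lambda>t. q (x + t *\<^sub>R y) - t * q y) ` {0..})"
  proof (rule bdd_belowI2)
    fix s :: real assume "s \<in> {0..}"
    then have "s * q y = q ((x + s *\<^sub>R y) + - x)"
      using sublinear_scaleR[OF assms(1)] by simp
    also have "\<dots> \<le> q (x + s *\<^sub>R y) + q (- x)"
      by (rule sublinear_add[OF assms(1)])
    finally show "- q (- x) \<le> q (x + s *\<^sub>R y) - s * q y" by simp
  qed
qed (use assms in simp)

lemma sublinear_along_ge:
  assumes "\<And>t. t \<ge> 0 \<Longrightarrow> a \<le> q (x + t *\<^sub>R y) - t * q y"
  shows "a \<le> sublinear_along q y x"
  unfolding sublinear_along_def by (rule cINF_greatest) (use assms in auto)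

lemma sublinear_along_le_self: "sublinear q \<Longrightarrow> sublinear_along q y x \<le> q x"
  using sublinear_along_le[of q 0 y x] by simp

text \<open>The parameters combine: \<open>s\<close> for \<open>x\<close> and \<open>t\<close> for
  \<open>x'\<close> give \<open>s + t\<close> for \<open>x + x'\<close>, and scaling by
  \<open>c\<close> replaces \<open>t\<close> by \<open>c * t\<close>. The two infima are then taken
  one after the other.\<close>

lemma sublinear_sublinear_along:
  assumes q: "sublinear q"
  shows "sublinear (sublinear_along q y)"
proof -
  let ?r = "sublinear_along q y"
  have add: "?r (x + x') \<le> ?r x + ?r x'" for x x'
  proof -
    have *: "?r (x + x') - (q (x + s *\<^sub>R y) - s * q y) \<le> q (x' + t *\<^sub>R y) - t * q y"
      if "s \<ge> 0" "t \<ge> 0" for s t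
    proof -
      have "?r (x + x') \<le> q ((x + x') + (s + t) *\<^sub>R y) - (s + t) * q y"
        using that by (intro sublinear_along_le q) auto
      also have "(x + x') + (s + t) *\<^sub>R y = (x + s *\<^sub>R y) + (x' + t *\<^sub>R y)"
        by (simp add: algebra_simps)
      also have "q \<dots> \<le> q (x + s *\<^sub>R y) + q (x' + t *\<^sub>R y)"
        by (rule sublinear_add[OF q])
      finally show ?thesis by (simp add: algebra_simps)
    qed
    have "?r (x + x') - (q (x + s *\<^sub>R y) - s * q y) \<le> ?r x'" if "s \<ge> 0" for s
      by (rule sublinear_along_ge) (rule *[OF that])
    then have "?r (x + x') - ?r x' \<le> q (x + s *\<^sub>R y) - s * q y" if "s \<ge> 0" for s
      using that by (simp add: algebra_simps)
    then have "?r (x + x') - ?r x' \<le> ?r x"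
      by (rule sublinear_along_ge)
    then show ?thesis by simp
  qed
  have scale: "?r (c *\<^sub>R x) \<le> c * ?r x" if "c \<ge> 0" for c x
  proof (cases "c = 0")
    case True
    then show ?thesis
      using sublinear_along_le_self[OF q, of y 0] sublinear_zero[OF q] by simp
  next
    case False
    then have c: "c > 0" using that by simp
    have "?r (c *\<^sub>R x) / c \<le> q (x + t *\<^sub>R y) - t * q y" if t: "t \<ge> 0" for t
    proof -
      have "?r (c *\<^sub>R x) \<le> q (c *\<^sub>R x + (c * t) *\<^sub>R y) - (c * t) * q y"
        using c t by (intro sublinear_along_le q) auto
      also have "c *\<^sub>R x + (c * t) *\<^sub>R y = c *\<^sub>R (x + t *\<^sub>R y)"
        by (simp add: algebra_simps)
      also have "q \<dots> = c * q (x + t *\<^sub>R y)"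
        using c by (intro sublinear_scaleR q) auto
      finally show ?thesis using c by (simp add: field_simps)
    qed
    then have "?r (c *\<^sub>R x) / c \<le> ?r x"
      by (rule sublinear_along_ge)
    then show ?thesis using c by (simp add: field_simps)
  qed
  show ?thesis unfolding sublinear_def using add scale by blast
qed

text \<open>Minimality leaves no room to lower \<open>q\<close> along any \<open>y\<close>, so
  \<open>sublinear_along q y = q\<close>. The parameter \<open>t = 1\<close> then gives
  \<open>q x + q y \<le> q (x + y)\<close>, the converse of subadditivity.\<close>

lemma sublinear_minimal_linear:
  assumes q: "sublinear q"
    and min: "\<And>r. sublinear r \<Longrightarrow> (\<And>x. r x \<le> q x) \<Longrightarrow> r = q"
  shows "linear q"
proof -
  have along: "sublinear_along q y = q" for y
    by (rule min) (use q in \<open>auto intro: sublinear_sublinear_along sublinear_along_le_self\<close>)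
  have add: "q (x + y) = q x + q y" for x y
    using sublinear_along_le[OF q, of 1 y x] sublinear_add[OF q, of x y] by (simp add: along)
  have neg: "q (- x) = - q x" for x
    using add[of x "- x"] sublinear_zero[OF q] by simp
  have "q (t *\<^sub>R x) = t *\<^sub>R q x" for t x
  proof (cases "t \<ge> 0")
    case True
    then show ?thesis using sublinear_scaleR[OF q] by simp
  next
    case False
    then show ?thesis
      using sublinear_scaleR[OF q, of "- t" x] neg[of "t *\<^sub>R x"] by simp
  qed
  then show ?thesis by (intro linearI add)
qed

lemma sublinear_INF_chain:
  assumes C: "C \<noteq> {}" and sub: "\<And>q. q \<in> C \<Longrightarrow> sublinear q"
    and bdd: "\<And>x. bdd_below ((\<lambda>q. q x) ` C)"
    and chain: "\<And>q r. q \<in> C \<Longrightarrow> r \<in> C \<Longrightarrow> (\<forall>x. q x \<le> r x) \<or> (\<forall>x. r x \<le> q x)"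
  shows "sublinear (\<lambda>x. INF q\<in>C. q x)"
proof -
  let ?Q = "\<lambda>x. INF q\<in>C. q x"
  have lower: "?Q x \<le> q x" if "q \<in> C" for q x
    by (rule cINF_lower[OF bdd that])
  have add: "?Q (x + y) \<le> ?Q x + ?Q y" for x y
  proof -
    \<comment> \<open>Comparability in the chain replaces \<open>q\<close> and \<open>r\<close> by
      the smaller one \<open>m\<close>, whose own subadditivity applies.\<close>
    have *: "?Q (x + y) - q x \<le> r y" if qr: "q \<in> C" "r \<in> C" for q r
    proof -
      obtain m where "m \<in> C" "m x \<le> q x" "m y \<le> r y"
        using chain[OF qr] qr by blast
      then show ?thesis
        using lower[of m "x + y"] sublinear_add[OF sub, of m x y] by simp
    qed
    have "?Q (x + y) - q x \<le> ?Q y" if "q \<in> C" for q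
      by (rule cINF_greatest[OF C]) (rule *[OF that])
    then have "?Q (x + y) - ?Q y \<le> ?Q x"
      by (intro cINF_greatest[OF C]) (simp add: algebra_simps)
    then show ?thesis by simp
  qed
  have scale: "?Q (t *\<^sub>R x) \<le> t * ?Q x" if "t \<ge> 0" for t x
  proof (cases "t = 0")
    case True
    obtain q where "q \<in> C" using C by blast
    then show ?thesis
      using lower[of q 0] sublinear_zero[OF sub, of q] True by simp
  next
    case False
    then have t: "t > 0" using that by simp
    have "?Q (t *\<^sub>R x) / t \<le> q x" if "q \<in> C" for q
      using lower[OF that, of "t *\<^sub>R x"] sublinear_scaleR[OF sub[OF that], of t x] t
      by (simp add: field_simps)
    then have "?Q (t *\<^sub>R x) / t \<le> ?Q x"
      by (intro cINF_greatest[OF C])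
    then show ?thesis using t by (simp add: field_simps)
  qed
  show ?thesis unfolding sublinear_def using add scale by blast
qed

lemma sublinear_dominates_linear:
  assumes p: "sublinear p"
  obtains f where "linear f" "\<And>x. f x \<le> p x"
proof -
  define A where "A = {q. sublinear q \<and> (\<forall>x. q x \<le> p x)}"
  \<comment> \<open>The order is reversed, so that the maximal element from Zorn's lemma is a
    minimal sublinear functional.\<close>
  define P :: "('a \<Rightarrow> real) \<Rightarrow> ('a \<Rightarrow> real) \<Rightarrow> bool" where "P = (\<lambda>q r. \<forall>x. r x \<le> q x)"
  have "\<exists>m\<in>A. \<forall>q\<in>A. P m q \<longrightarrow> q = m"
  proof (rule predicate_Zorn)
    show "partial_order_on A (relation_of P A)"
      by (rule partial_order_on_relation_ofI)
        (auto simp: P_def fun_eq_iff intro: order_trans order_antisym)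
  next
    fix C assume C: "C \<in> Chains (relation_of P A)"
    then have CA: "C \<subseteq> A" by (auto simp: Chains_def relation_of_def)
    have chain: "(\<forall>x. q x \<le> r x) \<or> (\<forall>x. r x \<le> q x)" if "q \<in> C" "r \<in> C" for q r
      using C that by (auto simp: Chains_def relation_of_def P_def)
    show "\<exists>m\<in>A. \<forall>q\<in>C. P q m"
    proof (cases "C = {}")
      case True
      then show ?thesis using p by (auto simp: A_def)
    next
      case False
      have sub: "sublinear q" if "q \<in> C" for q using that CA by (auto simp: A_def)
      \<comment> \<open>Every member satisfies \<open>q x \<ge> - q (- x) \<ge> - p (- x)\<close>, a
        bound that does not depend on \<open>q\<close>.\<close>
      have bdd: "bdd_below ((\<lambda>q. q x) ` C)" for x
      proof (rule bdd_belowI2)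
        fix q assume "q \<in> C"
        then have "q (- x) \<le> p (- x)" "- q (- x) \<le> q x"
          using sublinear_uminus[OF sub, of q x] CA by (auto simp: A_def)
        then show "- p (- x) \<le> q x" by linarith
      qed
      have lower: "(INF q\<in>C. q x) \<le> q x" if "q \<in> C" for q x
        by (rule cINF_lower[OF bdd that])
      have "sublinear (\<lambda>x. INF q\<in>C. q x)"
        by (rule sublinear_INF_chain) (use False sub bdd chain in auto)
      moreover obtain q where "q \<in> C" using False by blast
      then have "(INF q\<in>C. q x) \<le> p x" for x
        using CA by (intro order_trans[OF lower]) (auto simp: A_def)
      ultimately show ?thesis
        using lower by (intro bexI[of _ "\<lambda>x. INF q\<in>C. q x"]) (auto simp: A_def P_def)
    qed
  qed
  then obtain m where m: "m \<in> A" and min: "\<And>q. q \<in> A \<Longrightarrow> P m q \<Longrightarrow> q = m" by blast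
  have "linear m"
  proof (rule sublinear_minimal_linear)
    show "sublinear m" using m by (simp add: A_def)
    fix r assume "sublinear r" "\<And>x. r x \<le> m x"
    then show "r = m"
      using m by (intro min) (auto simp: A_def P_def intro: order_trans)
  qed
  with m show ?thesis by (intro that) (auto simp: A_def)
qed

text \<open>Any linear functional below \<open>sublinear_along p a\<close> has value at most
  \<open>- p a\<close> at \<open>- a\<close>, hence at least \<open>p a\<close> at \<open>a\<close>.
  No extension from a subspace is involved.\<close>

lemma Hahn_Banach_real:
  assumes p: "sublinear p"
  obtains f where "linear f" "\<And>x. f x \<le> p x" "f a = p a"
proof -
  obtain f where f: "linear f" and le: "\<And>x. f x \<le> sublinear_along p a x"
    using sublinear_dominates_linear[OF sublinear_sublinear_along[OF p]] by blast
  have fp: "f x \<le> p x" for x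
    using le[of x] sublinear_along_le_self[OF p, of a x] by linarith
  have "- f a \<le> p (- a + 1 *\<^sub>R a) - 1 * p a"
    using le[of "- a"] sublinear_along_le[OF p, of 1 a "- a"] linear_neg[OF f, of a] by simp
  then have "f a = p a"
    using fp[of a] sublinear_zero[OF p] by simp
  with f fp show ?thesis by (rule that)
qed

section \<open>Scalar fields isometric to the reals or the complex numbers\<close>

lemma real_or_complex_cases:
  obtains
    (real) h :: "'k::real_or_complex \<Rightarrow> real" where "bij h" "linear h"
      "\<And>x y. h (x * y) = h x * h y" "\<And>x. norm (h x) = norm x" "\<And>r. h (of_real r) = r"
  | (complex) h :: "'k::real_or_complex \<Rightarrow> complex" where "bij h" "linear h"
      "\<And>x y. h (x * y) = h x * h y" "\<And>x. norm (h x) = norm x" "\<And>r. h (of_real r) = of_real r"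
proof -
  have of_real: "h (of_real r) = of_real r"
    if "linear h" "\<And>x y. h (x * y) = h x * h y" "\<And>x. norm (h x) = norm x"
    for h :: "'k \<Rightarrow> 'b::real_normed_field" and r
  proof -
    \<comment> \<open>The value at 1 is a nonzero idempotent of a field, hence 1; real linearity
      then fixes all real scalars.\<close>
    have "h 1 \<noteq> 0" using that(3)[of 1] by auto
    then have "h 1 = 1" using that(2)[of 1 1] by simp
    then show ?thesis by (simp add: of_real_def linear_cmul[OF that(1)])
  qed
  from real_or_complex[where 'a = 'k] show ?thesis
  proof (elim disjE exE conjE)
    fix h :: "'k \<Rightarrow> real"
    assume h: "bij h" "\<forall>x y. h (x + y) = h x + h y" "\<forall>r x. h (r *\<^sub>R x) = r *\<^sub>R h x"
      "\<forall>x y. h (x * y) = h x * h y" "\<forall>x. norm (h x) = norm x"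
    have lin: "linear h" using h by (intro linearI) auto
    show ?thesis by (rule real[of h]) (use h lin of_real[OF lin] in auto)
  next
    fix h :: "'k \<Rightarrow> complex"
    assume h: "bij h" "\<forall>x y. h (x + y) = h x + h y" "\<forall>r x. h (r *\<^sub>R x) = r *\<^sub>R h x"
      "\<forall>x y. h (x * y) = h x * h y" "\<forall>x. norm (h x) = norm x"
    have lin: "linear h" using h by (intro linearI) auto
    show ?thesis by (rule complex[of h]) (use h lin of_real[OF lin] in auto)
  qed
qed

text \<open>
  The real part by polarisation; this formula is invariant under the isometric isomorphisms onto
  the reals and the complex numbers.
\<close>

definition scalar_Re :: "'k::real_or_complex \<Rightarrow> real" where
  "scalar_Re c = ((norm (1 + c))\<^sup>2 - (norm c)\<^sup>2 - 1) / 2"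

lemma scalar_Re_eq_real:
  fixes h :: "'k::real_or_complex \<Rightarrow> real"
  assumes "linear h" "\<And>x. norm (h x) = norm x" "\<And>r. h (of_real r) = r"
  shows "scalar_Re c = h c"
proof -
  have "h (1 + c) = 1 + h c"
    using linear_add[OF assms(1)] assms(3)[of 1] by simp
  then have "norm (1 + c) = \<bar>1 + h c\<bar>" "norm c = \<bar>h c\<bar>"
    by (simp_all flip: assms(2))
  then show ?thesis by (simp add: scalar_Re_def power2_eq_square algebra_simps)
qed

lemma scalar_Re_eq_complex:
  fixes h :: "'k::real_or_complex \<Rightarrow> complex"
  assumes "linear h" "\<And>x. norm (h x) = norm x" "\<And>r. h (of_real r) = of_real r"
  shows "scalar_Re c = Re (h c)"
proof -
  have "h (1 + c) = 1 + h c"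
    using linear_add[OF assms(1)] assms(3)[of 1] by simp
  then have "norm (1 + c) = norm (1 + h c)" "norm c = norm (h c)"
    by (simp_all flip: assms(2))
  moreover have "(norm (1 + h c))\<^sup>2 = 1 + 2 * Re (h c) + (norm (h c))\<^sup>2"
    unfolding cmod_power2 by (simp add: power2_eq_square algebra_simps)
  ultimately show ?thesis by (simp add: scalar_Re_def)
qed

lemma scalar_Re_add: "scalar_Re (x + y) = scalar_Re x + scalar_Re (y::'k::real_or_complex)"
proof (cases rule: real_or_complex_cases[where 'k = 'k])
  case (real h)
  then show ?thesis by (simp add: scalar_Re_eq_real[of h] linear_add)
next
  case (complex h)
  then show ?thesis by (simp add: scalar_Re_eq_complex[of h] linear_add)
qed

lemma scalar_Re_of_real [simp]: "scalar_Re (of_real r :: 'k::real_or_complex) = r"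
proof (cases rule: real_or_complex_cases[where 'k = 'k])
  case (real h)
  then show ?thesis by (simp add: scalar_Re_eq_real[of h])
next
  case (complex h)
  then show ?thesis by (simp add: scalar_Re_eq_complex[of h])
qed

lemma scalar_Re_le_norm: "scalar_Re (c::'k::real_or_complex) \<le> norm c"
proof (cases rule: real_or_complex_cases[where 'k = 'k])
  case (real h)
  then show ?thesis using abs_ge_self[of "h c"] by (simp add: scalar_Re_eq_real[of h])
next
  case (complex h)
  then show ?thesis
    using complex_Re_le_cmod[of "h c"] by (simp add: scalar_Re_eq_complex[of h])
qed

lemma eq_of_real_if_norm_le_scalar_Re:
  fixes c :: "'k::real_or_complex"
  assumes "norm c \<le> scalar_Re c"
  shows "c = of_real (scalar_Re c)"
proof (cases rule: real_or_complex_cases[where 'k = 'k])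
  case (real h)
  then have "h c = h (of_real (scalar_Re c))"
    by (simp add: scalar_Re_eq_real[of h])
  then show ?thesis using real(1) by (simp add: bij_def inj_eq)
next
  case (complex h)
  then have Re: "scalar_Re c = Re (h c)" by (simp add: scalar_Re_eq_complex[of h])
  with assms complex(4)[of c] have "cmod (h c) \<le> Re (h c)" by simp
  \<comment> \<open>The squared modulus is the sum of the squares of the real and imaginary parts,
    so a modulus bounded by the real part leaves nothing for the imaginary part.\<close>
  then have "Im (h c) = 0"
    by (metis cmod_eq_Re cmod_Re_le_iff complex_Re_le_cmod norm_ge_zero abs_of_nonneg
        order_antisym order_trans cmod_power2 power2_eq_square add_cancel_left_right
        mult_eq_0_iff)
  then have "h c = h (of_real (scalar_Re c))"
    using Re complex(5) by (simp add: complex_eq_iff)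
  then show ?thesis using complex(1) by (simp add: bij_def inj_eq)
qed

text \<open>Compactness is transported from the real or complex unit sphere: the inverse of the
  isometry is 1-Lipschitz and maps that sphere onto this one.\<close>

lemma compact_sphere_scalar: "compact (sphere 0 1 :: 'k::real_or_complex set)"
proof -
  have *: "compact (sphere 0 1 :: 'k set)"
    if h: "bij h" "linear h" "\<And>x. norm (h x) = norm x"
    for h :: "'k \<Rightarrow> 'b::euclidean_space"
  proof -
    have hg: "h (inv h y) = y" and gh: "inv h (h x) = x" for x y
      using h(1) by (simp_all add: bij_def surj_f_inv_f)
    have "1-lipschitz_on (sphere 0 1) (inv h)"
    proof (rule lipschitz_onI)
      fix x y
      have "dist (inv h x) (inv h y) = norm (h (inv h x - inv h y))"
        by (simp add: h(3) dist_norm)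
      then show "dist (inv h x) (inv h y) \<le> 1 * dist x y"
        by (simp add: linear_diff[OF h(2)] hg dist_norm)
    qed simp
    then have "continuous_on (sphere 0 1) (inv h)"
      by (rule lipschitz_on_continuous_on)
    then have "compact (inv h ` sphere 0 1)"
      by (rule compact_continuous_image) (rule compact_sphere)
    moreover have "inv h ` sphere 0 1 = sphere 0 1"
    proof (intro equalityI subsetI)
      fix x assume "x \<in> inv h ` sphere 0 1"
      then show "x \<in> sphere 0 1" by (auto simp: hg simp flip: h(3))
    next
      fix x :: 'k assume "x \<in> sphere 0 1"
      then show "x \<in> inv h ` sphere 0 1" by (intro image_eqI[of _ _ "h x"]) (auto simp: gh h(3))
    qed
    ultimately show ?thesis by simp
  qed
  show ?thesis
    by (cases rule: real_or_complex_cases[where 'k = 'k]) (auto intro: *)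
qed

section \<open>Norming functionals\<close>

context banach_over
begin

lemma linear_functional_iff:
  "Vector_Spaces.linear scl (*) F \<longleftrightarrow>
    (\<forall>x y. F (x + y) = F x + F y) \<and> (\<forall>c x. F (scl c x) = c * F x)"
proof -
  have "vector_space ((*) :: 'k \<Rightarrow> 'k \<Rightarrow> 'k)"
    by unfold_locales (simp_all add: algebra_simps)
  then show ?thesis
    using vector_space_axioms by (simp add: Vector_Spaces.linear_iff)
qed

text \<open>Over the complex numbers this is the classical formula
  \<open>F x = f x - i f (i x)\<close>; over the reals \<open>F\<close> is \<open>f\<close> itself.
  Both are read through the identification \<open>h\<close> of the scalar field.\<close>

lemma linear_functional_with_scalar_Re:
  assumes f: "linear f"
  obtains F where "Vector_Spaces.linear scl (*) F" "\<And>x. scalar_Re (F x) = f x"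
proof -
  have linI: "Vector_Spaces.linear scl (*) F"
    if "\<And>x y. F (x + y) = F x + F y" "\<And>c x. F (scl c x) = c * F x" for F
    using that by (simp add: linear_functional_iff)
  show ?thesis
  proof (cases rule: real_or_complex_cases[where 'k = 'k])
    case (real h)
    have hg: "h (inv h y) = y" for y using real(1) by (simp add: bij_def surj_f_inv_f)
    have eqI: "x = y" if "h x = h y" for x y using real(1) that by (simp add: bij_def inj_eq)
    have "f (scl c x) = h c * f x" for c x
    proof -
      have "c = of_real (h c)" by (rule eqI) (simp add: real)
      then show ?thesis by (metis scl_of_real linear_cmul[OF f] real_scaleR_def)
    qed
    then show ?thesis
      by (intro that[of "\<lambda>x. inv h (f x)"] linI eqI)
        (simp_all add: hg real linear_add[OF f] linear_add[OF real(2)]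
          scalar_Re_eq_real[OF real(2,4,5)])
  next
    case (complex h)
    \<comment> \<open>\<open>J\<close> is the imaginary unit of the abstract scalar field.\<close>
    define J where "J = inv h \<i>"
    define G where "G x = Complex (f x) (- f (scl J x))" for x
    have hg: "h (inv h y) = y" for y using complex(1) by (simp add: bij_def surj_f_inv_f)
    have eqI: "x = y" if "h x = h y" for x y using complex(1) that by (simp add: bij_def inj_eq)
    have J: "h J = \<i>" by (simp add: J_def hg)
    have JJ: "J * J = - 1"
      by (rule eqI) (use complex(5)[of "-1"] in \<open>simp add: complex(3) J\<close>)
    have G_add: "G (x + y) = G x + G y" for x y
      by (simp add: G_def complex_eq_iff linear_add[OF f] scale_right_distrib)
    have G_scl: "G (scl c x) = h c * G x" for c x
    proof -
      let ?a = "Re (h c)" and ?b = "Im (h c)"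
      \<comment> \<open>Real and imaginary parts split every scalar, so homogeneity of
        \<open>G\<close> reduces to real scalars, where \<open>f\<close> is linear, and to
        \<open>J\<close>, where \<open>J * J = - 1\<close> is used.\<close>
      have c: "c = of_real ?a + of_real ?b * J"
        by (rule eqI) (simp add: linear_add[OF complex(2)] complex(3) complex(5) J complex_eq_iff)
      have fc: "f (scl c y) = ?a * f y + ?b * f (scl J y)" for y
        by (subst c) (simp add: scale_left_distrib scl_of_real linear_add[OF f] linear_cmul[OF f]
            flip: scale_scale)
      have "scl J (scl J x) = - x"
        by (metis JJ scale_scale scale_minus_left scale_one)
      then have "f (scl J (scl J x)) = - f x"
        by (simp add: linear_neg[OF f])
      moreover have "scl J (scl c x) = scl c (scl J x)"
        by (simp add: mult.commute)
      ultimately have "f (scl J (scl c x)) = ?a * f (scl J x) - ?b * f x"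
        by (simp only: fc)
      then show ?thesis by (simp add: G_def complex_eq_iff fc)
    qed
    show ?thesis
      by (intro that[of "\<lambda>x. inv h (G x)"] linI eqI)
        (simp_all add: hg complex G_add G_scl linear_add[OF complex(2)]
          scalar_Re_eq_complex[OF complex(2,4,5)], simp add: G_def)
  qed
qed

lemma Hahn_Banach:
  assumes add: "\<And>x y. p (x + y) \<le> p x + p y" and scl: "\<And>c x. p (scl c x) = norm c * p x"
  obtains F where "Vector_Spaces.linear scl (*) F" "\<And>x. norm (F x) \<le> p x"
    "F a = of_real (p a)"
proof -
  have "sublinear p"
    unfolding sublinear_def using add scl[of "of_real _"] by (simp add: scl_of_real)
  then obtain f where f: "linear f" "\<And>x. f x \<le> p x" "f a = p a"
    by (rule Hahn_Banach_real[where a = a]) (rule that)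
  obtain F where F: "Vector_Spaces.linear scl (*) F" "\<And>x. scalar_Re (F x) = f x"
    using linear_functional_with_scalar_Re[OF f(1)] by blast
  have bound: "norm (F x) \<le> p x" for x
  proof (cases "F x = 0")
    case True
    \<comment> \<open>Nonnegativity of \<open>p\<close> follows from subadditivity at
      \<open>x\<close> and \<open>- x\<close>.\<close>
    have "0 = p 0" using scl[of 0 0] by simp
    also have "\<dots> \<le> 2 * p x" using add[of x "- x"] scl[of "- 1" x] by simp
    finally show ?thesis using True by simp
  next
    case False
    \<comment> \<open>Multiplication by this unimodular scalar rotates \<open>F x\<close> onto the
      nonnegative real axis, where the bound on the real part \<open>f\<close> controls the full
      norm; \<open>p\<close> is invariant under the rotation.\<close>
    define c where "c = of_real (norm (F x)) / F x"
    have c: "norm c = 1" using False by (simp add: c_def norm_divide)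
    have "F (scl c x) = of_real (norm (F x))"
      using F(1) False by (simp add: linear_functional_iff c_def)
    then have "norm (F x) = f (scl c x)" using F(2)[of "scl c x"] by simp
    also have "\<dots> \<le> p (scl c x)" by (rule f(2))
    finally show ?thesis by (simp add: scl c)
  qed
  \<comment> \<open>The norm of \<open>F a\<close> is at most its real part \<open>p a\<close>, so
    \<open>F a\<close> is that real number.\<close>
  have "F a = of_real (p a)"
    using eq_of_real_if_norm_le_scalar_Re[of "F a"] bound[of a] by (simp add: F(2) f(3))
  with F(1) bound show ?thesis by (rule that)
qed

section \<open>Functionals of norm one\<close>

lemma dual_sphere_add: "\<phi> \<in> dual_sphere scl \<Longrightarrow> \<phi> (x + y) = \<phi> x + \<phi> y"
  and dual_sphere_scl: "\<phi> \<in> dual_sphere scl \<Longrightarrow> \<phi> (scl c x) = c * \<phi> x"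
  by (simp_all add: dual_sphere_def linear_functional_iff)

lemma norm_dual_sphere_le: "\<phi> \<in> dual_sphere scl \<Longrightarrow> norm (\<phi> x) \<le> norm x"
  using onorm[of \<phi> x] by (simp add: dual_sphere_def)

text \<open>The nonzero vector \<open>a\<close> at which the norm is attained raises the operator
  norm from at most 1 to exactly 1.\<close>

lemma dual_sphereI:
  assumes lin: "Vector_Spaces.linear scl (*) \<phi>"
    and le: "\<And>x. norm (\<phi> x) \<le> norm x" and a: "norm (\<phi> a) = norm a" "a \<noteq> 0"
  shows "\<phi> \<in> dual_sphere scl"
proof -
  have "\<phi> (r *\<^sub>R x) = r *\<^sub>R \<phi> x" for r x
    using lin scl_of_real[of r x] by (metis linear_functional_iff scaleR_conv_of_real)
  then have bl: "bounded_linear \<phi>"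
    using lin le by (intro bounded_linear_intro[where K = 1]) (auto simp: linear_functional_iff)
  have "onorm \<phi> \<le> 1"
    by (rule onorm_bound) (use le in auto)
  moreover have "1 \<le> onorm \<phi>"
    using onorm[OF bl, of a] a by simp
  ultimately show ?thesis
    using lin bl by (simp add: dual_sphere_def)
qed

lemma dual_sphere_uminus:
  assumes "\<phi> \<in> dual_sphere scl"
  shows "(\<lambda>x. - \<phi> x) \<in> dual_sphere scl"
  using assms onorm_neg[of \<phi>]
  by (simp add: dual_sphere_def linear_functional_iff bounded_linear_minus)

lemma norming_functional:
  assumes "a \<noteq> 0"
  obtains \<phi> where "\<phi> \<in> dual_sphere scl" "\<phi> a = of_real (norm a)"
proof -
  obtain F where "Vector_Spaces.linear scl (*) F" "\<And>x. norm (F x) \<le> norm x"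
    "F a = of_real (norm a)"
    by (rule Hahn_Banach[of norm a]) (auto simp: norm_scl intro: norm_triangle_ineq)
  then show ?thesis using assms by (intro that[of F] dual_sphereI[of F a]) auto
qed

section \<open>Smooth points and Birkhoff-James orthogonality\<close>

lemma smooth_unique:
  assumes "z \<in> Smooth scl" "\<phi> \<in> dual_sphere scl" "\<psi> \<in> dual_sphere scl"
    and "\<phi> z = of_real (norm z)" "\<psi> z = of_real (norm z)"
  shows "\<phi> = \<psi>"
proof -
  obtain \<rho> where \<rho>: "{\<phi> \<in> dual_sphere scl. \<phi> z = of_real (norm z)} = {\<rho>}"
    using assms(1) by (auto simp: Smooth_def elim: is_singletonE)
  have "\<phi> \<in> {\<rho>}" "\<psi> \<in> {\<rho>}"
    unfolding \<rho>[symmetric] using assms(2-) by simp_all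
  then show ?thesis by simp
qed

text \<open>At 0 the support condition holds for every functional of the dual sphere, hence for both
  \<phi> and its negative. The unit vector \<open>u\<close> guarantees that such a \<phi>
  exists.\<close>

lemma smooth_nonzero:
  assumes u: "norm (u :: 'z) = 1" and z: "z \<in> Smooth scl"
  shows "z \<noteq> 0"
proof
  assume "z = 0"
  obtain \<phi> where \<phi>: "\<phi> \<in> dual_sphere scl" "\<phi> u = 1"
    using norming_functional[of u] u by force
  have "\<phi> 0 = 0" using dual_sphere_add[OF \<phi>(1), of 0 0] by simp
  then have "\<phi> = (\<lambda>x. - \<phi> x)"
    using \<open>z = 0\<close> by (intro smooth_unique[OF z \<phi>(1) dual_sphere_uminus[OF \<phi>(1)]]) auto
  then have "\<phi> u = - \<phi> u" by meson
  with \<phi>(2) show False by simp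
qed

lemma bj_orth_functional:
  assumes orth: "bj_orth scl z u" and z: "z \<noteq> 0"
  obtains \<phi> where "\<phi> \<in> dual_sphere scl" "\<phi> z = of_real (norm z)" "\<phi> u = 0"
proof -
  \<comment> \<open>The distance from \<open>x\<close> to the line spanned by \<open>u\<close>.
    Orthogonality says that this distance is \<open>norm z\<close> at \<open>z\<close>.\<close>
  define p where "p x = (INF c. norm (x + scl c u))" for x
  have bdd: "bdd_below (range (\<lambda>c. norm (x + scl c u)))" for x
    by (rule bdd_belowI2[of _ 0]) simp
  have lower: "p x \<le> norm (x + scl c u)" for x c
    unfolding p_def by (rule cINF_lower[OF bdd]) simp
  have greatest: "b \<le> p x" if "\<And>c. b \<le> norm (x + scl c u)" for b x
    unfolding p_def by (rule cINF_greatest) (use that in auto)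
  have nonneg: "0 \<le> p x" for x by (rule greatest) simp
  have p_le: "p x \<le> norm x" for x using lower[of x 0] by simp
  have "p (x + y) \<le> p x + p y" for x y
  proof -
    have *: "p (x + y) - norm (x + scl c u) \<le> norm (y + scl d u)" for c d
    proof -
      have "p (x + y) \<le> norm ((x + scl c u) + (y + scl d u))"
        using lower[of "x + y" "c + d"] by (simp add: scale_left_distrib algebra_simps)
      then show ?thesis
        using norm_triangle_ineq[of "x + scl c u" "y + scl d u"] by linarith
    qed
    have "p (x + y) - norm (x + scl c u) \<le> p y" for c
      by (rule greatest) (rule *)
    then have "p (x + y) - p y \<le> p x"
      by (intro greatest) (simp add: algebra_simps)
    then show ?thesis by simp
  qed
  moreover have "p (scl c x) = norm c * p x" for c x
  proof -
    have le: "p (scl c x) \<le> norm c * p x" if "c \<noteq> 0" for c x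
    proof -
      have "p (scl c x) / norm c \<le> norm (x + scl d u)" for d
      proof -
        have "p (scl c x) \<le> norm (scl c (x + scl d u))"
          using lower[of "scl c x" "c * d"] by (simp add: scale_right_distrib)
        then show ?thesis
          using that norm_scl[of c "x + scl d u"] by (simp add: field_simps)
      qed
      then have "p (scl c x) / norm c \<le> p x" by (rule greatest)
      then show ?thesis using that by (simp add: field_simps)
    qed
    show ?thesis
    proof (cases "c = 0")
      case True
      then show ?thesis using p_le[of 0] nonneg[of 0] by simp
    next
      case False
      \<comment> \<open>The converse inequality is the one already proved, applied to
        \<open>inverse c\<close> and \<open>scl c x\<close>.\<close>
      have "p x \<le> p (scl c x) / norm c"
        using le[of "inverse c" "scl c x"] False by (simp add: norm_inverse norm_divide field_simps)
      then show ?thesis using le[OF False, of x] False by (simp add: field_simps)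
    qed
  qed
  ultimately obtain F where F: "Vector_Spaces.linear scl (*) F" "\<And>x. norm (F x) \<le> p x"
    "F z = of_real (p z)"
    by (rule Hahn_Banach[where a = z]) (rule that)
  have "norm z \<le> p z" by (rule greatest) (use orth in \<open>simp add: bj_orth_def\<close>)
  then have "p z = norm z" using p_le[of z] by simp
  \<comment> \<open>The scalar \<open>- 1\<close> shows that \<open>u\<close> has distance 0 from
    its own line.\<close>
  moreover have "F u = 0"
    using order_trans[OF F(2)[of u] lower[of u "- 1"]] by simp
  moreover have "norm (F x) \<le> norm x" for x
    using F(2)[of x] p_le[of x] by linarith
  ultimately show ?thesis
    using F z by (intro that[of F] dual_sphereI[of F z]) auto
qed

section \<open>The numerical radius and spear vectors\<close>

lemma norm_le_num_radius:
  assumes "\<phi> \<in> dual_sphere scl" "\<phi> u = 1"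
  shows "norm (\<phi> z) \<le> num_radius scl u z"
  unfolding num_radius_def
proof (rule cSUP_upper)
  show "bdd_above ((\<lambda>\<phi>. norm (\<phi> z)) ` {\<phi> \<in> dual_sphere scl. \<phi> u = 1})"
    by (rule bdd_aboveI2[of _ _ "norm z"]) (simp add: norm_dual_sphere_le)
qed (use assms in simp)

text \<open>The norming functional of \<open>u\<close> makes the index set nonempty, as bounding its
  supremum from above requires.\<close>

lemma num_radius_le:
  assumes u: "norm u = 1"
    and b: "\<And>\<phi>. \<phi> \<in> dual_sphere scl \<Longrightarrow> \<phi> u = 1 \<Longrightarrow> norm (\<phi> z) \<le> b"
  shows "num_radius scl u z \<le> b"
  unfolding num_radius_def
proof (rule cSUP_least)
  show "{\<phi> \<in> dual_sphere scl. \<phi> u = 1} \<noteq> {}"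
    using norming_functional[of u] u by force
qed (use b in auto)

text \<open>Let \<theta> maximise \<open>norm (z + scl \<theta> u)\<close> over the unit sphere of
  scalars. Each functional defining the numerical radius, after aligning \<open>u\<close> with its
  phase at \<open>z\<close>, bounds this maximum below by \<open>norm (\<phi> z) + 1\<close>; the
  supremum of these bounds is \<open>norm z + 1\<close>.\<close>

lemma spear_norm_add:
  assumes u: "u \<in> Spear scl"
  obtains \<theta> where "norm \<theta> = 1" "norm (z + scl \<theta> u) = norm z + 1"
proof -
  have u1: "norm u = 1" using u by (simp add: Spear_def)
  define g where "g \<theta> = norm (z + scl \<theta> u)" for \<theta>
  have "1-lipschitz_on (sphere 0 1) g"
  proof (rule lipschitz_onI)
    fix x y
    have "dist (g x) (g y) \<le> norm (scl x u - scl y u)"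
      using norm_triangle_ineq3[of "z + scl x u" "z + scl y u"] by (simp add: g_def dist_real_def)
    also have "\<dots> = norm (scl (x - y) u)" by (simp add: scale_left_diff_distrib)
    finally show "dist (g x) (g y) \<le> 1 * dist x y"
      by (simp add: norm_scl u1 dist_norm)
  qed simp
  then have cont: "continuous_on (sphere 0 1) g"
    by (rule lipschitz_on_continuous_on)
  have "(1::'k) \<in> sphere 0 1" by simp
  then have "sphere 0 1 \<noteq> ({} :: 'k set)" by blast
  then obtain \<theta> where \<theta>: "norm \<theta> = 1" "\<And>c. norm c = 1 \<Longrightarrow> g c \<le> g \<theta>"
    using continuous_attains_sup[OF compact_sphere_scalar _ cont] by auto
  have "norm (\<phi> z) \<le> g \<theta> - 1" if \<phi>: "\<phi> \<in> dual_sphere scl" "\<phi> u = 1" for \<phi>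
  proof -
    \<comment> \<open>The phase of \<open>\<phi> z\<close>; the value 1 at zero keeps
      \<open>c\<close> unimodular.\<close>
    define c where "c = (if \<phi> z = 0 then 1 else \<phi> z / of_real (norm (\<phi> z)))"
    have c: "norm c = 1" by (simp add: c_def norm_divide)
    have "\<phi> (z + scl c u) = of_real (norm (\<phi> z) + 1) * c"
      by (simp add: dual_sphere_add \<phi> dual_sphere_scl c_def algebra_simps)
    then have "norm (\<phi> (z + scl c u)) = norm (\<phi> z) + 1"
      by (simp add: norm_mult c del: of_real_add)
    then show ?thesis
      using norm_dual_sphere_le[OF \<phi>(1), of "z + scl c u"] \<theta>(2)[OF c] by (simp add: g_def)
  qed
  then have "num_radius scl u z \<le> g \<theta> - 1"
    by (rule num_radius_le[OF u1])
  moreover have "num_radius scl u z = norm z"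
    using u by (simp add: Spear_def)
  moreover have "g \<theta> \<le> norm z + 1"
    using norm_triangle_ineq[of z "scl \<theta> u"] by (simp add: g_def norm_scl u1 \<theta>)
  ultimately show ?thesis
    using \<theta>(1) by (intro that[of \<theta>]) (simp_all add: g_def)
qed

text \<open>A functional norming \<open>z + scl \<theta> u\<close> must attain both parts of the sum
  \<open>norm z + 1\<close>: the real parts of \<open>\<phi> z\<close> and
  \<open>\<theta> * \<phi> u\<close> are at most \<open>norm z\<close> and 1.\<close>

lemma spear_support_functional:
  assumes u: "u \<in> Spear scl"
  obtains \<phi> where "\<phi> \<in> dual_sphere scl" "\<phi> z = of_real (norm z)" "\<phi> u \<noteq> 0"
proof -
  have u1: "norm u = 1" using u by (simp add: Spear_def)
  obtain \<theta> where \<theta>: "norm \<theta> = 1" "norm (z + scl \<theta> u) = norm z + 1"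
    using spear_norm_add[OF u] .
  then have "z + scl \<theta> u \<noteq> 0"
    by (metis add_nonneg_eq_0_iff norm_ge_zero norm_zero zero_le_one zero_neq_one)
  then obtain \<phi> where \<phi>: "\<phi> \<in> dual_sphere scl" "\<phi> (z + scl \<theta> u) = of_real (norm z + 1)"
    using norming_functional[of "z + scl \<theta> u"] \<theta>(2) by metis
  have sum: "\<phi> z + \<theta> * \<phi> u = of_real (norm z + 1)"
    using \<phi>(2) by (simp only: dual_sphere_add[OF \<phi>(1)] dual_sphere_scl[OF \<phi>(1)])
  then have "scalar_Re (\<phi> z) + scalar_Re (\<theta> * \<phi> u) = norm z + 1"
    by (metis scalar_Re_add scalar_Re_of_real)
  moreover have "scalar_Re (\<theta> * \<phi> u) \<le> 1"
    using scalar_Re_le_norm[of "\<theta> * \<phi> u"] norm_dual_sphere_le[OF \<phi>(1), of u] \<theta>(1) u1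
    by (simp add: norm_mult)
  moreover have "norm (\<phi> z) \<le> norm z" by (rule norm_dual_sphere_le[OF \<phi>(1)])
  ultimately have "scalar_Re (\<phi> z) = norm z" "norm (\<phi> z) \<le> scalar_Re (\<phi> z)"
    using scalar_Re_le_norm[of "\<phi> z"] by auto
  then have z: "\<phi> z = of_real (norm z)"
    using eq_of_real_if_norm_le_scalar_Re[of "\<phi> z"] by simp
  \<comment> \<open>If \<open>\<phi> u\<close> vanished, \<open>norm z\<close> would equal
    \<open>norm z + 1\<close>.\<close>
  with sum have "\<phi> u \<noteq> 0" by auto
  with \<phi>(1) z show ?thesis by (rule that)
qed

lemma smooth_not_bj_orth_spear:
  assumes z: "z \<in> Smooth scl" and u: "u \<in> Spear scl"
  shows "\<not> bj_orth scl z u"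
proof
  assume "bj_orth scl z u"
  moreover have "z \<noteq> 0" using u by (intro smooth_nonzero[of u, OF _ z]) (simp add: Spear_def)
  ultimately obtain \<phi> where \<phi>: "\<phi> \<in> dual_sphere scl" "\<phi> z = of_real (norm z)" "\<phi> u = 0"
    by (rule bj_orth_functional)
  obtain \<psi> where \<psi>: "\<psi> \<in> dual_sphere scl" "\<psi> z = of_real (norm z)" "\<psi> u \<noteq> 0"
    using spear_support_functional[OF u] .
  have "\<phi> = \<psi>"
    using \<phi> \<psi> by (intro smooth_unique[OF z])
  with \<phi> \<psi> show False by simp
qed

lemma spear_if_isometric_isomorphism:
  assumes u: "norm u = 1"
    and T: "isometric_isomorphism scl (num_radius scl u) norm T" "T u = u"
  shows "u \<in> Spear scl"
proof -
  have lin: "Vector_Spaces.linear scl scl T" and bij: "bij T"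
    and norm_T: "norm (T z) = num_radius scl u z" for z
    using T by (simp_all add: isometric_isomorphism_def)
  have T_add: "T (x + y) = T x + T y" and T_scl: "T (scl c x) = scl c (T x)" for x y c
    using lin by (simp_all add: Vector_Spaces.linear_iff)
  let ?S = "inv T"
  have TS: "T (?S x) = x" and ST: "?S (T x) = x" for x
    using bij by (simp_all add: bij_def surj_f_inv_f)
  have S_add: "?S (x + y) = ?S x + ?S y" for x y
    by (metis T_add TS ST)
  have S_scl: "?S (scl c x) = scl c (?S x)" for c x
    by (metis T_scl TS ST)
  have S_u: "?S u = u" using ST[of u] T(2) by simp
  have "num_radius scl u z = norm z" for z
  proof (rule antisym)
    show "num_radius scl u z \<le> norm z"
      by (rule num_radius_le[OF u]) (rule norm_dual_sphere_le)
    have "norm (\<phi> (?S z)) \<le> num_radius scl u z" if \<phi>: "\<phi> \<in> dual_sphere scl" "\<phi> u = 1" for \<phi>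
    proof -
      \<comment> \<open>The numerical radius of \<open>?S x\<close> is \<open>norm x\<close> because
        \<open>T\<close> is isometric; this bounds the composite by 1, and its value 1 at the fixed
        vector \<open>u\<close> shows that the bound is attained.\<close>
      have "norm (\<phi> (?S x)) \<le> norm x" for x
        using norm_le_num_radius[OF \<phi>, of "?S x"] by (simp add: TS flip: norm_T)
      then have "(\<lambda>x. \<phi> (?S x)) \<in> dual_sphere scl"
        using u by (intro dual_sphereI[where a = u])
          (auto simp: linear_functional_iff S_add S_scl S_u \<phi> dual_sphere_add dual_sphere_scl)
      then show ?thesis
        using norm_le_num_radius[of "\<lambda>x. \<phi> (?S x)" u z] \<phi>(2) S_u by simp
    qed
    \<comment> \<open>The left-hand side is \<open>norm z\<close> by the isometry, which gives the
      inequality missing for a spear vector.\<close>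
    then have "num_radius scl u (?S z) \<le> num_radius scl u z"
      by (rule num_radius_le[OF u])
    then show "norm z \<le> num_radius scl u z" using norm_T[of "?S z"] by (simp add: TS)
  qed
  with u show ?thesis by (simp add: Spear_def)
qed

end

theorem corollary5p3:
  fixes scl :: "'k::real_or_complex \<Rightarrow> 'z::banach \<Rightarrow> 'z"
  assumes "banach_over scl"
  shows "(\<forall>u \<in> sphere 0 1. (\<exists>z0 \<in> Smooth scl. bj_orth scl z0 u) \<longrightarrow>
            \<not> (\<exists>T. isometric_isomorphism scl (num_radius scl u) norm T \<and> T u = u) \<and> u \<notin> Spear scl)
       \<and> (\<Union>z \<in> Smooth scl. right_perp scl z) \<inter> Spear scl = {}
       \<and> Smooth scl \<inter> (\<Union>z \<in> Spear scl. left_perp scl z) = {}"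
proof -
  interpret banach_over scl by (rule assms)
  show ?thesis
  proof (intro conjI ballI impI)
    fix u :: 'z
    assume "u \<in> sphere 0 1" and "\<exists>z0 \<in> Smooth scl. bj_orth scl z0 u"
    then have u: "norm u = 1" and not_spear: "u \<notin> Spear scl"
      using smooth_not_bj_orth_spear by auto
    then show "u \<notin> Spear scl"
      "\<not> (\<exists>T. isometric_isomorphism scl (num_radius scl u) norm T \<and> T u = u)"
      using spear_if_isometric_isomorphism[OF u] by blast+
  \<comment> \<open>Both intersection formulas unfold to the absence of a smooth point orthogonal to
    a spear vector.\<close>
  qed (use smooth_not_bj_orth_spear in \<open>auto simp: right_perp_def left_perp_def\<close>)
qed

end
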